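(* For any integer $N\ge0$, in the basis $(\varphi_\alpha)$ of the space $$\mathcal{H}_N^{\mathcal{B}}=\mathrm{Span}\Big\{\varphi_\alpha=\frac{\zeta_1^{\alpha_1}\zeta_2^{\alpha_2}}{2\pi\hbar\sqrt{\alpha_1!\,\alpha_2!}}\;;\ \alpha=(\alpha_1,\alpha_2)\in\mathbb{N}^2,\ \alpha_1+2\alpha_2=N\Big\},$$ ordered by $\alpha_2$ (that is, $\alpha=(N-2\ell,\ell)$, $\ell=0,1,\dots,\lfloor N/2\rfloor$), of size $\lfloor N/2\rfloor+1$, the matrix of the operator $\hat K_{3,\varepsilon}^{\mathcal{B}}$ is the symmetric tridiagonal matrix $\mathcal{M}_{\varepsilon,N}$ with diagonal entries $d_{N,0},d_{N,1},\dots,d_{N,\lfloor N/2\rfloor}$ and with the entries in positions $(\ell,\ell+1)$ and $(\ell+1,\ell)$ (rows and columns indexed from $0$) both equal to $A_{N,\ell}$, all other entries being zero, where for $\ell=0,1,\dots,\lfloor N/2\rfloor$ $$A_{N,\ell}=\sqrt2\,\mu\,\hbar^{3/2}\sqrt{(\ell+1)(N-2\ell)(N-2\ell-1)},$$ $$d_{N,\ell}=\hbar\varepsilon\,\omega_{1,1}\big(N-2\ell+\tfrac12\big)+\hbar\varepsilon\,\omega_{2,1}\big(\ell+\tfrac12\big).$$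
   Context: $\hbar>0$ and $\varepsilon\in\mathbb{R}$ are parameters. The operator $\hat K_{3,\varepsilon}^{\mathcal{B}}$ is the conjugate by the Bargmann transform of the Weyl quantization of $K_{3,\varepsilon}=\frac{\omega_{1,1}}2\varepsilon|z_1|^2+\frac{\omega_{2,1}}2\varepsilon|z_2|^2+\mu\,\mathrm{Re}(z_1^2\bar z_2)$, $z_j=x_j+i\xi_j$; explicitly, it is the differential operator acting on holomorphic functions (in particular polynomials) of $(\zeta_1,\zeta_2)\in\mathbb{C}^2$ $$\hat K_{3,\varepsilon}^{\mathcal{B}}=\hbar\varepsilon\,\omega_{1,1}\Big(\zeta_1\frac{\partial}{\partial\zeta_1}+\tfrac12\Big)+\hbar\varepsilon\,\omega_{2,1}\Big(\zeta_2\frac{\partial}{\partial\zeta_2}+\tfrac12\Big)+\sqrt2\,\mu\,\hbar^{3/2}\Big(\zeta_2\frac{\partial^2}{\partial\zeta_1^2}+\zeta_1^2\frac{\partial}{\partial\zeta_2}\Big).$$ The real constants come from a smooth family of potentials $V_\varepsilon$ on $\mathbb{R}^2$ with a non-degenerate minimum $x_\varepsilon$ ($x_0=0$): $\omega_{j,\varepsilon}=\omega_{j,0}+\varepsilon\,\omega_{j,1}+\mathcal{O}(\varepsilon^2)$, $j=1,2$, are the smooth positive frequencies whose squares are the eigenvalues of $V_\varepsilon''(x_\varepsilon)$ modulo $\mathcal{O}(\varepsilon^\infty)$, with $\omega_{2,0}=2\omega_{1,0}$, and $$\mu=\frac{1}{8\sqrt2\,\omega_{1,0}^{3/2}(1+z^2)^{3/2}}\Big(z\,\partial^3_{x_1^3}V_0(0)+(1-2z^2)\partial^3_{x_1^2x_2}V_0(0)+(z^3-2z)\partial^3_{x_1x_2^2}V_0(0)+z^2\partial^3_{x_2^3}V_0(0)\Big),$$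 $$\omega_{1,0}=\tfrac{1}{\sqrt3}\Big[\big(\partial^2_{x_1^2}V_0(0)-\partial^2_{x_2^2}V_0(0)\big)^2+4\big(\partial^2_{x_1x_2}V_0(0)\big)^2\Big]^{1/4},\qquad z=\frac{2|\partial^2_{x_1x_2}V_0(0)|}{3\omega_{1,0}^2-\partial^2_{x_1^2}V_0(0)+\partial^2_{x_2^2}V_0(0)}$$ (the last denominator being nonzero). *)

theory Defs
  imports
    "HOL-Analysis.Analysis"
    "HOL-Library.Function_Algebras"
    "HOL-Library.Landau_Symbols"
    "Jordan_Normal_Form.Char_Poly"
begin

definition partial1 :: "('a::real_normed_field \<times> 'a \<Rightarrow> 'a) \<Rightarrow> 'a \<times> 'a \<Rightarrow> 'a" where
  "partial1 f = (\<lambda>(u, v). deriv (\<lambda>w. f (w, v)) u)"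

definition partial2 :: "('a::real_normed_field \<times> 'a \<Rightarrow> 'a) \<Rightarrow> 'a \<times> 'a \<Rightarrow> 'a" where
  "partial2 f = (\<lambda>(u, v). deriv (\<lambda>w. f (u, w)) v)"

text \<open>On an open subset of a finite-dimensional space, \<open>Ck_on k S f\<close> says that \<open>f\<close> is of
  class \<open>C^k\<close> on \<open>S\<close>: all iterated directional derivatives up to order \<open>k\<close> exist and are
  continuous.\<close>

primrec Ck_on :: "nat \<Rightarrow> 'a::real_normed_vector set \<Rightarrow> ('a \<Rightarrow> 'b::real_normed_vector) \<Rightarrow> bool" where
  "Ck_on 0 S f \<longleftrightarrow> continuous_on S f"
| "Ck_on (Suc k) S f \<longleftrightarrow>
     (\<forall>x\<in>S. f differentiable (at x)) \<and>
     (\<forall>v. Ck_on k S (\<lambda>x. frechet_derivative f (at x) v))"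

definition smooth_on :: "'a::real_normed_vector set \<Rightarrow> ('a \<Rightarrow> 'b::real_normed_vector) \<Rightarrow> bool" where
  "smooth_on S f \<longleftrightarrow> (\<forall>k. Ck_on k S f)"

definition hessian :: "(real \<times> real \<Rightarrow> real) \<Rightarrow> real \<times> real \<Rightarrow> real mat" where
  "hessian f x = mat_of_rows_list 2
     [[partial1 (partial1 f) x, partial1 (partial2 f) x],
      [partial2 (partial1 f) x, partial2 (partial2 f) x]]"

definition nondegenerate_minimum :: "(real \<times> real \<Rightarrow> real) \<Rightarrow> real \<times> real \<Rightarrow> bool" where
  "nondegenerate_minimum f x \<longleftrightarrow>
     (\<forall>\<^sub>F y in nhds x. f x \<le> f y) \<and> Determinant.det (hessian f x) \<noteq> 0"

text \<open>The filter \<open>nhds 0\<close> (rather than \<open>at 0\<close>) includes the point 0 itself, so that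
  \<open>O(\<epsilon>^\<infinity>)\<close> forces equality at \<open>\<epsilon> = 0\<close>.  The eigenvalues \<open>\<nu>1, \<nu>2\<close> of the Hessian are
  counted with multiplicity, through the characteristic polynomial.\<close>

definition resonant_potential_family ::
  "(real \<Rightarrow> real \<times> real \<Rightarrow> real) \<Rightarrow> (real \<Rightarrow> real \<times> real) \<Rightarrow>
   (real \<Rightarrow> real) \<Rightarrow> (real \<Rightarrow> real) \<Rightarrow> real \<Rightarrow> real \<Rightarrow> bool" where
  "resonant_potential_family V x \<omega>1 \<omega>2 \<omega>11 \<omega>21 \<longleftrightarrow>
     (\<exists>r>0.
        smooth_on ({-r<..<r} \<times> UNIV) (\<lambda>(\<epsilon>, y). V \<epsilon> y) \<and>
        (\<forall>\<epsilon>\<in>{-r<..<r}. nondegenerate_minimum (V \<epsilon>) (x \<epsilon>)) \<and>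
        x 0 = (0, 0) \<and>
        smooth_on {-r<..<r} \<omega>1 \<and> smooth_on {-r<..<r} \<omega>2 \<and>
        (\<forall>\<epsilon>\<in>{-r<..<r}. \<omega>1 \<epsilon> > 0 \<and> \<omega>2 \<epsilon> > 0) \<and>
        (\<exists>\<nu>1 \<nu>2.
           (\<forall>\<epsilon>\<in>{-r<..<r}.
              char_poly (hessian (V \<epsilon>) (x \<epsilon>)) = [:- \<nu>1 \<epsilon>, 1:] * [:- \<nu>2 \<epsilon>, 1:]) \<and>
           (\<forall>k::nat. (\<lambda>\<epsilon>. (\<omega>1 \<epsilon>)\<^sup>2 - \<nu>1 \<epsilon>) \<in> O[nhds 0](\<lambda>\<epsilon>. \<epsilon> ^ k)) \<and>
           (\<forall>k::nat. (\<lambda>\<epsilon>. (\<omega>2 \<epsilon>)\<^sup>2 - \<nu>2 \<epsilon>) \<in> O[nhds 0](\<lambda>\<epsilon>. \<epsilon> ^ k))) \<and>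
        \<omega>2 0 = 2 * \<omega>1 0 \<and>
        (\<lambda>\<epsilon>. \<omega>1 \<epsilon> - (\<omega>1 0 + \<epsilon> * \<omega>11)) \<in> O[nhds 0](\<lambda>\<epsilon>. \<epsilon>\<^sup>2) \<and>
        (\<lambda>\<epsilon>. \<omega>2 \<epsilon> - (\<omega>2 0 + \<epsilon> * \<omega>21)) \<in> O[nhds 0](\<lambda>\<epsilon>. \<epsilon>\<^sup>2))"

definition omega10 :: "(real \<times> real \<Rightarrow> real) \<Rightarrow> real" where
  "omega10 V0 = 1 / sqrt 3 *
     ((partial1 (partial1 V0) (0, 0) - partial2 (partial2 V0) (0, 0))\<^sup>2
       + 4 * (partial1 (partial2 V0) (0, 0))\<^sup>2) powr (1 / 4)"

definition zden :: "(real \<times> real \<Rightarrow> real) \<Rightarrow> real" where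
  "zden V0 = 3 * (omega10 V0)\<^sup>2 - partial1 (partial1 V0) (0, 0) + partial2 (partial2 V0) (0, 0)"

definition zpar :: "(real \<times> real \<Rightarrow> real) \<Rightarrow> real" where
  "zpar V0 = 2 * \<bar>partial1 (partial2 V0) (0, 0)\<bar> / zden V0"

definition mu :: "(real \<times> real \<Rightarrow> real) \<Rightarrow> real" where
  "mu V0 = (let z = zpar V0 in
     1 / (8 * sqrt 2 * omega10 V0 powr (3 / 2) * (1 + z\<^sup>2) powr (3 / 2)) *
     (z * partial1 (partial1 (partial1 V0)) (0, 0)
      + (1 - 2 * z\<^sup>2) * partial1 (partial1 (partial2 V0)) (0, 0)
      + (z ^ 3 - 2 * z) * partial1 (partial2 (partial2 V0)) (0, 0)
      + z\<^sup>2 * partial2 (partial2 (partial2 V0)) (0, 0)))"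

definition K3B ::
  "real \<Rightarrow> real \<Rightarrow> real \<Rightarrow> real \<Rightarrow> real \<Rightarrow>
   (complex \<times> complex \<Rightarrow> complex) \<Rightarrow> complex \<times> complex \<Rightarrow> complex" where
  "K3B \<omega>11 \<omega>21 \<mu> h \<epsilon> f = (\<lambda>(\<zeta>1, \<zeta>2).
     of_real (h * \<epsilon> * \<omega>11) * (\<zeta>1 * partial1 f (\<zeta>1, \<zeta>2) + 1 / 2 * f (\<zeta>1, \<zeta>2))
     + of_real (h * \<epsilon> * \<omega>21) * (\<zeta>2 * partial2 f (\<zeta>1, \<zeta>2) + 1 / 2 * f (\<zeta>1, \<zeta>2))
     + of_real (sqrt 2 * \<mu> * h powr (3 / 2)) *
         (\<zeta>2 * partial1 (partial1 f) (\<zeta>1, \<zeta>2) + \<zeta>1\<^sup>2 * partial2 f (\<zeta>1, \<zeta>2)))"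

definition cfun_scale ::
  "complex \<Rightarrow> (complex \<times> complex \<Rightarrow> complex) \<Rightarrow> complex \<times> complex \<Rightarrow> complex" where
  "cfun_scale c f = (\<lambda>\<zeta>. c * f \<zeta>)"

global_interpretation cfun: vector_space cfun_scale
  by unfold_locales (auto simp: cfun_scale_def fun_eq_iff algebra_simps)

definition ordered_basis ::
  "(nat \<Rightarrow> complex \<times> complex \<Rightarrow> complex) \<Rightarrow> nat \<Rightarrow> (complex \<times> complex \<Rightarrow> complex) set \<Rightarrow> bool" where
  "ordered_basis b n W \<longleftrightarrow>
     inj_on b {..<n} \<and> cfun.independent (b ` {..<n}) \<and> cfun.span (b ` {..<n}) = W"

text \<open>Column \<open>j\<close> holds the coordinates of \<open>T (b j)\<close>.  Meaningful only when \<open>b\<close> is an ordered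
  basis of a space mapped into itself by \<open>T\<close>.\<close>

definition matrix_in_basis ::
  "((complex \<times> complex \<Rightarrow> complex) \<Rightarrow> complex \<times> complex \<Rightarrow> complex) \<Rightarrow>
   (nat \<Rightarrow> complex \<times> complex \<Rightarrow> complex) \<Rightarrow> nat \<Rightarrow> complex mat" where
  "matrix_in_basis T b n =
     Matrix.mat n n (\<lambda>(i, j). cfun.representation (b ` {..<n}) (T (b j)) (b i))"

definition phi :: "real \<Rightarrow> nat \<times> nat \<Rightarrow> complex \<times> complex \<Rightarrow> complex" where
  "phi h \<alpha> = (\<lambda>(\<zeta>1, \<zeta>2). \<zeta>1 ^ fst \<alpha> * \<zeta>2 ^ snd \<alpha> /
     of_real (2 * pi * h * sqrt (fact (fst \<alpha>) * fact (snd \<alpha>))))"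

definition HNB :: "real \<Rightarrow> nat \<Rightarrow> (complex \<times> complex \<Rightarrow> complex) set" where
  "HNB h N = cfun.span {phi h \<alpha> | \<alpha>. fst \<alpha> + 2 * snd \<alpha> = N}"

definition A_entry :: "real \<Rightarrow> real \<Rightarrow> nat \<Rightarrow> nat \<Rightarrow> real" where
  "A_entry \<mu> h N l = sqrt 2 * \<mu> * h powr (3 / 2) *
     sqrt ((real l + 1) * (real N - 2 * real l) * (real N - 2 * real l - 1))"

definition d_entry :: "real \<Rightarrow> real \<Rightarrow> real \<Rightarrow> real \<Rightarrow> nat \<Rightarrow> nat \<Rightarrow> real" where
  "d_entry \<omega>11 \<omega>21 h \<epsilon> N l =
     h * \<epsilon> * \<omega>11 * (real N - 2 * real l + 1 / 2) + h * \<epsilon> * \<omega>21 * (real l + 1 / 2)"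

definition M_matrix :: "real \<Rightarrow> real \<Rightarrow> real \<Rightarrow> real \<Rightarrow> real \<Rightarrow> nat \<Rightarrow> real mat" where
  "M_matrix \<omega>11 \<omega>21 \<mu> h \<epsilon> N = Matrix.mat (N div 2 + 1) (N div 2 + 1) (\<lambda>(i, j).
     if i = j then d_entry \<omega>11 \<omega>21 h \<epsilon> N i
     else if j = i + 1 then A_entry \<mu> h N i
     else if i = j + 1 then A_entry \<mu> h N j
     else 0)"

end

theory Submission
  imports Defs
begin

text \<open>The operator preserves \<open>\<alpha>\<^sub>1 + 2 \<alpha>\<^sub>2\<close>: the Euler fields act diagonally on
  \<open>\<phi>\<^sub>\<alpha>\<close>, while \<open>\<zeta>\<^sub>2 \<partial>\<^sub>1\<^sup>2\<close> and \<open>\<zeta>\<^sub>1\<^sup>2 \<partial>\<^sub>2\<close> shift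
  \<open>\<alpha>\<close> by \<open>(-2, 1)\<close> and \<open>(2, -1)\<close>. The normalisation by \<open>\<surd>(\<alpha>\<^sub>1! \<alpha>\<^sub>2!)\<close> makes
  the two shifts adjoint to each other, whence the symmetry. At the ends of the chain the shifted
  coefficient vanishes, so nothing leaves the space.\<close>

section \<open>Coefficients of finite linear combinations of an indexed family of functions\<close>

lemma sum_fun_apply: "(\<Sum>i\<in>I. f i) x = (\<Sum>i\<in>I. f i x)"
  by (induction I rule: infinite_finite_induct) auto

lemma inj_on_of_lincomb_zero:
  fixes b :: "nat \<Rightarrow> complex \<times> complex \<Rightarrow> complex"
  assumes "\<And>c. (\<Sum>i<n. cfun_scale (c i) (b i)) = 0 \<Longrightarrow> \<forall>i<n. c i = 0"
  shows "inj_on b {..<n}"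
proof (rule inj_onI, rule ccontr)
  fix i j assume ij: "i \<in> {..<n}" "j \<in> {..<n}" "b i = b j" "i \<noteq> j"
  define c :: "nat \<Rightarrow> complex" where "c k = (if k = i then 1 else 0) - (if k = j then 1 else 0)" for k
  have "(\<Sum>k<n. cfun_scale (c k) (b k))
      = (\<Sum>k<n. (if k = i then b k else 0) - (if k = j then b k else 0))"
    by (intro sum.cong) (auto simp: c_def cfun_scale_def fun_eq_iff)
  also have "\<dots> = b i - b j" using ij(1,2) by (simp add: sum_subtractf)
  finally have "(\<Sum>k<n. cfun_scale (c k) (b k)) = 0" using ij(3) by simp
  then have "c i = 0" using assms[of c] ij by simp
  then show False using ij by (simp add: c_def)
qed

text \<open>Library independence concerns sets of vectors; injectivity of \<open>b\<close> turns a
  relation over the image into one over the indices.\<close>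

lemma independent_of_lincomb_zero:
  fixes b :: "nat \<Rightarrow> complex \<times> complex \<Rightarrow> complex"
  assumes "\<And>c. (\<Sum>i<n. cfun_scale (c i) (b i)) = 0 \<Longrightarrow> \<forall>i<n. c i = 0"
  shows "cfun.independent (b ` {..<n})"
proof -
  have inj: "inj_on b {..<n}" by (rule inj_on_of_lincomb_zero) (rule assms)
  show ?thesis
  proof (subst cfun.dependent_finite)
    show "finite (b ` {..<n})" by simp
    show "\<not> (\<exists>u. (\<exists>v\<in>b ` {..<n}. u v \<noteq> 0) \<and> (\<Sum>v\<in>b ` {..<n}. cfun_scale (u v) v) = 0)"
    proof
      assume "\<exists>u. (\<exists>v\<in>b ` {..<n}. u v \<noteq> 0) \<and> (\<Sum>v\<in>b ` {..<n}. cfun_scale (u v) v) = 0"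
      then obtain u where u: "\<exists>v\<in>b ` {..<n}. u v \<noteq> 0"
        "(\<Sum>v\<in>b ` {..<n}. cfun_scale (u v) v) = 0" by blast
      have "(\<Sum>i<n. cfun_scale (u (b i)) (b i)) = 0"
        using u(2) by (simp add: sum.reindex[OF inj])
      from assms[OF this] u(1) show False by auto
    qed
  qed
qed

text \<open>Coordinates are linear, and injectivity makes the \<open>b k\<close> coordinate of
  \<open>b i\<close> a Kronecker delta. This serves to read off the entries of a matrix
  column.\<close>

lemma representation_lincomb:
  fixes b :: "nat \<Rightarrow> complex \<times> complex \<Rightarrow> complex"
  assumes "inj_on b {..<n}" "cfun.independent (b ` {..<n})" "k < n"
  shows "cfun.representation (b ` {..<n}) (\<Sum>i<n. cfun_scale (c i) (b i)) (b k) = c k"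
proof -
  let ?B = "b ` {..<n}"
  have sp: "b i \<in> cfun.span ?B" if "i < n" for i
    using that by (auto intro: cfun.span_base)
  have "cfun.representation ?B (\<Sum>i<n. cfun_scale (c i) (b i)) (b k)
      = (\<Sum>i<n. cfun.representation ?B (cfun_scale (c i) (b i)) (b k))"
    using assms(2) by (subst cfun.representation_sum) (auto intro: cfun.span_scale sp)
  also have "\<dots> = (\<Sum>i<n. if i = k then c i else 0)"
  proof (rule sum.cong[OF refl])
    fix i assume "i \<in> {..<n}"
    then show "cfun.representation ?B (cfun_scale (c i) (b i)) (b k) = (if i = k then c i else 0)"
      using assms sp
      by (simp add: cfun.representation_scale cfun.representation_basis inj_on_eq_iff[OF assms(1)])
  qed
  also have "\<dots> = c k" using assms(3) by simp
  finally show ?thesis .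
qed

section \<open>The normalised monomials as an ordered basis\<close>

definition phi_norm :: "real \<Rightarrow> nat \<Rightarrow> nat \<Rightarrow> complex" where
  "phi_norm h a b = of_real (2 * pi * h * sqrt (fact a * fact b))"

lemma phi_norm_nonzero: "h \<noteq> 0 \<Longrightarrow> phi_norm h a b \<noteq> 0"
  by (simp add: phi_norm_def)

lemma phi_eq: "phi h (a, b) = (\<lambda>(u, v). u ^ a * v ^ b / phi_norm h a b)"
  by (simp add: phi_def phi_norm_def)

text \<open>At the points \<open>(1, t)\<close> the first factor equals 1 whatever its exponent, so
  the combination becomes a polynomial in \<open>t\<close> that vanishes identically; the distinct
  powers \<open>t ^ l\<close> separate the coefficients.\<close>

lemma phi_lincomb_zero:
  assumes "h \<noteq> 0" and "(\<Sum>l<Suc m. cfun_scale (c l) (phi h (N - 2 * l, l))) = 0"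
  shows "\<forall>l<Suc m. c l = 0"
proof -
  have "(\<Sum>l\<le>m. c l / phi_norm h (N - 2 * l) l * t ^ l) = 0" for t
    using fun_cong[OF assms(2), of "(1, t)"]
    by (simp add: sum_fun_apply cfun_scale_def phi_eq lessThan_Suc_atMost)
  then have "\<forall>l\<le>m. c l / phi_norm h (N - 2 * l) l = 0"
    by (subst polyfun_eq_0[symmetric]) simp
  then show ?thesis using phi_norm_nonzero[OF assms(1)] by (simp add: less_Suc_eq_le)
qed

lemma HNB_eq_span: "HNB h N = cfun.span ((\<lambda>l. phi h (N - 2 * l, l)) ` {..<N div 2 + 1})"
proof -
  have "{phi h \<alpha> | \<alpha>. fst \<alpha> + 2 * snd \<alpha> = N} = (\<lambda>l. phi h (N - 2 * l, l)) ` {..<N div 2 + 1}"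
  proof (intro equalityI subsetI)
    fix f assume "f \<in> {phi h \<alpha> | \<alpha>. fst \<alpha> + 2 * snd \<alpha> = N}"
    then obtain a b where "f = phi h (a, b)" "a + 2 * b = N" by auto
    then show "f \<in> (\<lambda>l. phi h (N - 2 * l, l)) ` {..<N div 2 + 1}"
      by (intro image_eqI[of _ _ b]) auto
  next
    fix f assume "f \<in> (\<lambda>l. phi h (N - 2 * l, l)) ` {..<N div 2 + 1}"
    then obtain l where l: "f = phi h (N - 2 * l, l)" "l < N div 2 + 1" by auto
    \<comment> \<open>The bound on \<open>l\<close> ensures that the subtraction of naturals does
      not truncate.\<close>
    then have "N - 2 * l + 2 * l = N" by linarith
    with l(1) show "f \<in> {phi h \<alpha> | \<alpha>. fst \<alpha> + 2 * snd \<alpha> = N}" by force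
  qed
  then show ?thesis by (simp add: HNB_def)
qed

lemma ordered_basis_phi:
  assumes "h \<noteq> 0"
  shows "ordered_basis (\<lambda>l. phi h (N - 2 * l, l)) (N div 2 + 1) (HNB h N)"
proof -
  let ?n = "N div 2 + 1" and ?b = "\<lambda>l. phi h (N - 2 * l, l)"
  have lin: "\<forall>l<?n. c l = 0" if "(\<Sum>l<?n. cfun_scale (c l) (?b l)) = 0" for c
    using phi_lincomb_zero[OF assms, where m = "N div 2", unfolded Suc_eq_plus1, OF that] .
  have "inj_on ?b {..<?n}" by (rule inj_on_of_lincomb_zero) (rule lin)
  moreover have "cfun.independent (?b ` {..<?n})" by (rule independent_of_lincomb_zero) (rule lin)
  ultimately show ?thesis unfolding ordered_basis_def HNB_eq_span by blast
qed

section \<open>Action of the operator on a single monomial\<close>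

lemma partial1_monomial:
  fixes k :: complex
  shows "partial1 (\<lambda>(u, v). k * u ^ a * v ^ b) = (\<lambda>(u, v). (k * of_nat a) * u ^ (a - 1) * v ^ b)"
  unfolding partial1_def
  by (auto simp: fun_eq_iff intro!: DERIV_imp_deriv derivative_eq_intros)

lemma partial2_monomial:
  fixes k :: complex
  shows "partial2 (\<lambda>(u, v). k * u ^ a * v ^ b) = (\<lambda>(u, v). (k * of_nat b) * u ^ a * v ^ (b - 1))"
  unfolding partial2_def
  by (auto simp: fun_eq_iff intro!: DERIV_imp_deriv derivative_eq_intros)

text \<open>With the constant in front, \<open>partial1_monomial\<close> and
  \<open>partial2_monomial\<close> apply; they return a function of the same shape, so second
  derivatives need no separate rule.\<close>

lemma phi_eq_monomial: "phi h (a, b) = (\<lambda>(u, v). inverse (phi_norm h a b) * u ^ a * v ^ b)"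
  by (simp add: phi_eq fun_eq_iff field_simps)

text \<open>The coefficient of the shift by \<open>(-2, 1)\<close>. Two derivatives yield
  \<open>(a + 2) * (a + 1)\<close>, and the change of normalisation contributes
  \<open>sqrt ((b + 1) / ((a + 2) * (a + 1)))\<close>.\<close>

lemma inverse_phi_norm_lower:
  assumes "h \<noteq> 0"
  shows "inverse (phi_norm h (Suc (Suc a)) b) * of_nat (Suc (Suc a)) * of_nat (Suc a)
    = of_real (sqrt (real (Suc b) * real (Suc (Suc a)) * real (Suc a)))
      * inverse (phi_norm h a (Suc b))"
proof -
  \<comment> \<open>With the square roots as atoms, and each plain factor written as the square of
    its root, the claim becomes a rational identity.\<close>
  define s where "s = sqrt (fact a * fact b)"
  define p q r where "p = sqrt (real (Suc b))" and "q = sqrt (real (Suc (Suc a)))"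
    and "r = sqrt (real (Suc a))"
  have nz: "s \<noteq> 0" "p \<noteq> 0" "q \<noteq> 0" "r \<noteq> 0"
    by (simp_all add: s_def p_def q_def r_def del: of_nat_Suc)
  have 1: "sqrt (fact (Suc (Suc a)) * fact b) = q * r * s"
    by (simp add: s_def q_def r_def real_sqrt_mult del: of_nat_Suc)
  have 2: "sqrt (fact a * fact (Suc b)) = p * s"
    by (simp add: s_def p_def real_sqrt_mult del: of_nat_Suc)
  have 3: "sqrt (real (Suc b) * real (Suc (Suc a)) * real (Suc a)) = p * q * r"
    by (simp add: p_def q_def r_def real_sqrt_mult del: of_nat_Suc)
  have 4: "real (Suc (Suc a)) = q * q" "real (Suc a) = r * r"
    by (simp_all add: q_def r_def del: of_nat_Suc)
  have "inverse (2 * pi * h * (q * r * s)) * (q * q) * (r * r)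
      = p * q * r * inverse (2 * pi * h * (p * s))"
    using nz assms by (simp add: field_simps)
  then have "inverse (2 * pi * h * sqrt (fact (Suc (Suc a)) * fact b)) * real (Suc (Suc a)) * real (Suc a)
      = sqrt (real (Suc b) * real (Suc (Suc a)) * real (Suc a))
        * inverse (2 * pi * h * sqrt (fact a * fact (Suc b)))"
    by (simp only: 1 2 3) (simp only: 4)
  from arg_cong[OF this, of complex_of_real] show ?thesis
    unfolding phi_norm_def by (simp only: of_real_mult of_real_inverse of_real_of_nat_eq)
qed

text \<open>The reverse shift carries the same root, which is the source of the symmetry. Since the
  square of the root is \<open>(b + 1) * (a + 2) * (a + 1)\<close>, the claim follows from the
  lowering identity after multiplication by \<open>(a + 2) * (a + 1)\<close>.\<close>

lemma inverse_phi_norm_raise: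
  assumes "h \<noteq> 0"
  shows "inverse (phi_norm h a (Suc b)) * of_nat (Suc b)
    = of_real (sqrt (real (Suc b) * real (Suc (Suc a)) * real (Suc a)))
      * inverse (phi_norm h (Suc (Suc a)) b)"
proof -
  let ?s = "complex_of_real (sqrt (real (Suc b) * real (Suc (Suc a)) * real (Suc a)))"
  let ?x = "of_nat (Suc (Suc a)) * of_nat (Suc a) :: complex"
  have x: "?x \<noteq> 0" by (simp del: of_nat_Suc)
  have "?s * ?s = of_nat (Suc b) * ?x"
    by (simp only: of_real_mult[symmetric] real_sqrt_mult_self) (simp del: of_nat_Suc)
  then have "?x * (inverse (phi_norm h a (Suc b)) * of_nat (Suc b))
      = ?s * (?s * inverse (phi_norm h a (Suc b)))"
    by (simp only: mult.assoc[symmetric]) (simp only: mult_ac)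
  also have "\<dots> = ?x * (?s * inverse (phi_norm h (Suc (Suc a)) b))"
    by (subst inverse_phi_norm_lower[OF assms, symmetric]) (simp only: mult_ac)
  finally show ?thesis using x by (simp only: mult_cancel_left) simp
qed

text \<open>For \<open>a < 2\<close> or \<open>b = 0\<close> the truncated index is harmless, as its coefficient is zero.\<close>

lemma K3B_phi:
  assumes "h \<noteq> 0"
  shows "K3B w1 w2 \<mu> h \<epsilon> (phi h (a, b)) =
    cfun_scale (of_real (h * \<epsilon> * w1 * (real a + 1 / 2) + h * \<epsilon> * w2 * (real b + 1 / 2)))
      (phi h (a, b))
    + cfun_scale (of_real (sqrt 2 * \<mu> * h powr (3 / 2)
        * sqrt (real (Suc b) * real a * (real a - 1)))) (phi h (a - 2, Suc b))
    + cfun_scale (of_real (sqrt 2 * \<mu> * h powr (3 / 2)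
        * sqrt (real b * real (a + 2) * real (a + 1)))) (phi h (a + 2, b - 1))"
proof (rule ext, clarify)
  fix u v :: complex
  let ?k = "inverse (phi_norm h a b)"
  let ?f = "phi h (a, b)"
  have e1: "u * partial1 ?f (u, v) = of_nat a * ?f (u, v)"
    unfolding phi_eq_monomial partial1_monomial by (cases a) simp_all
  have e2: "v * partial2 ?f (u, v) = of_nat b * ?f (u, v)"
    unfolding phi_eq_monomial partial2_monomial by (cases b) simp_all
  have e3: "v * partial1 (partial1 ?f) (u, v)
      = of_real (sqrt (real (Suc b) * real a * (real a - 1))) * phi h (a - 2, Suc b) (u, v)"
  proof (cases "a < 2")
    case True
    then have "a = 0 \<or> a = 1" by auto
    then show ?thesis unfolding phi_eq_monomial partial1_monomial by auto
  next
    case False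
    then obtain c where a: "a = Suc (Suc c)" by (metis add_2_eq_Suc le_Suc_ex not_less)
    have "v * partial1 (partial1 ?f) (u, v)
        = (?k * of_nat (Suc (Suc c)) * of_nat (Suc c)) * (u ^ c * v ^ Suc b)"
      unfolding phi_eq_monomial partial1_monomial by (simp add: a del: of_nat_Suc)
    also have "\<dots> = of_real (sqrt (real (Suc b) * real a * real (Suc c)))
        * (inverse (phi_norm h c (Suc b)) * u ^ c * v ^ Suc b)"
      unfolding a inverse_phi_norm_lower[OF assms] by (simp only: mult_ac)
    finally show ?thesis by (simp add: a phi_eq_monomial)
  qed
  have e4: "u\<^sup>2 * partial2 ?f (u, v)
      = of_real (sqrt (real b * real (a + 2) * real (a + 1))) * phi h (a + 2, b - 1) (u, v)"
  proof (cases b)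
    case 0
    then show ?thesis unfolding phi_eq_monomial partial2_monomial by simp
  next
    case (Suc c)
    have "u\<^sup>2 * partial2 ?f (u, v) = (?k * of_nat (Suc c)) * (u ^ (a + 2) * v ^ c)"
      unfolding phi_eq_monomial partial2_monomial
      by (simp add: Suc power_add power2_eq_square del: of_nat_Suc)
    also have "\<dots> = of_real (sqrt (real (Suc c) * real (Suc (Suc a)) * real (Suc a)))
        * (inverse (phi_norm h (Suc (Suc a)) c) * u ^ (a + 2) * v ^ c)"
      unfolding Suc inverse_phi_norm_raise[OF assms] by (simp only: mult_ac)
    finally show ?thesis by (simp add: Suc phi_eq_monomial)
  qed
  show "K3B w1 w2 \<mu> h \<epsilon> (phi h (a, b)) (u, v) =
    (cfun_scale (of_real (h * \<epsilon> * w1 * (real a + 1 / 2) + h * \<epsilon> * w2 * (real b + 1 / 2)))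
      (phi h (a, b))
    + cfun_scale (of_real (sqrt 2 * \<mu> * h powr (3 / 2)
        * sqrt (real (Suc b) * real a * (real a - 1)))) (phi h (a - 2, Suc b))
    + cfun_scale (of_real (sqrt 2 * \<mu> * h powr (3 / 2)
        * sqrt (real b * real (a + 2) * real (a + 1)))) (phi h (a + 2, b - 1))) (u, v)"
    unfolding K3B_def cfun_scale_def plus_fun_def prod.case e1 e2 e3 e4
    by (simp only: of_real_mult of_real_add of_real_divide of_real_1 of_real_numeral
        of_real_of_nat_eq) (simp only: distrib_left distrib_right mult_ac add_ac)
qed

text \<open>Column \<open>j\<close> has at most three nonzero entries, one for each term of
  \<open>K3B_phi\<close>; the work lies in matching indices at the two ends of the chain.\<close>

lemma K3B_phi_eq_lincomb:
  assumes "h \<noteq> 0" and j: "j < N div 2 + 1"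
  shows "K3B w1 w2 \<mu> h \<epsilon> (phi h (N - 2 * j, j)) =
    (\<Sum>i<N div 2 + 1. cfun_scale (of_real (M_matrix w1 w2 \<mu> h \<epsilon> N $$ (i, j))) (phi h (N - 2 * i, i)))"
proof -
  let ?n = "N div 2 + 1" and ?b = "\<lambda>l. phi h (N - 2 * l, l)"
  have a: "real (N - 2 * j) = real N - 2 * real j"
    using j by (simp add: of_nat_diff)
  \<comment> \<open>The third term is guarded because for \<open>j = 0\<close> the truncated index
    \<open>j - 1\<close> would fall on the diagonal.\<close>
  have split: "cfun_scale (of_real (M_matrix w1 w2 \<mu> h \<epsilon> N $$ (i, j))) (?b i) =
      (if i = j then cfun_scale (of_real (d_entry w1 w2 h \<epsilon> N j)) (?b j) else 0)
      + (if i = Suc j then cfun_scale (of_real (A_entry \<mu> h N j)) (?b (Suc j)) else 0)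
      + (if i = j - 1 then (if j = 0 then 0 else cfun_scale (of_real (A_entry \<mu> h N (j - 1))) (?b (j - 1))) else 0)"
    if "i < ?n" for i
    using that j by (auto simp: M_matrix_def cfun_scale_def zero_fun_def plus_fun_def)
  have up: "cfun_scale (of_real (sqrt 2 * \<mu> * h powr (3 / 2)
        * sqrt (real (Suc j) * real (N - 2 * j) * (real (N - 2 * j) - 1)))) (phi h (N - 2 * j - 2, Suc j))
      = (if Suc j < ?n then cfun_scale (of_real (A_entry \<mu> h N j)) (?b (Suc j)) else 0)"
  proof (cases "Suc j < ?n")
    case True
    then show ?thesis unfolding a by (simp add: A_entry_def add.commute)
  next
    case False
    \<comment> \<open>At the last index only the parity of \<open>N\<close> is left as exponent of
      the first variable, so one factor of the radicand vanishes.\<close>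
    with j have "N - 2 * j = 0 \<or> N - 2 * j = 1" by linarith
    with False show ?thesis by (auto simp: cfun_scale_def zero_fun_def)
  qed
  \<comment> \<open>The entry above the diagonal in column \<open>j\<close> is indexed by its row
    \<open>j - 1\<close>; for \<open>j = 0\<close> the factor \<open>real j\<close> kills the
    coefficient.\<close>
  have down: "cfun_scale (of_real (sqrt 2 * \<mu> * h powr (3 / 2)
        * sqrt (real j * real (N - 2 * j + 2) * real (N - 2 * j + 1)))) (phi h (N - 2 * j + 2, j - 1))
      = (if j = 0 then 0 else cfun_scale (of_real (A_entry \<mu> h N (j - 1))) (?b (j - 1)))"
  proof (cases j)
    case 0
    then show ?thesis by (simp add: cfun_scale_def zero_fun_def)
  next
    case (Suc k)
    have 1: "N - 2 * j + 2 = N - 2 * k" using Suc j by linarith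
    have 2: "real (N - 2 * j + 2) = real N - 2 * real k" "real (N - 2 * j + 1) = real N - 2 * real k - 1"
      using a Suc by simp_all
    show ?thesis unfolding 2 unfolding 1 by (simp add: Suc A_entry_def add.commute)
  qed
  have "(\<Sum>i<?n. cfun_scale (of_real (M_matrix w1 w2 \<mu> h \<epsilon> N $$ (i, j))) (?b i))
      = cfun_scale (of_real (d_entry w1 w2 h \<epsilon> N j)) (?b j)
      + (if Suc j < ?n then cfun_scale (of_real (A_entry \<mu> h N j)) (?b (Suc j)) else 0)
      + (if j = 0 then 0 else cfun_scale (of_real (A_entry \<mu> h N (j - 1))) (?b (j - 1)))"
    using j by (simp add: split sum.distrib del: One_nat_def)
  then show ?thesis
    unfolding K3B_phi[OF assms(1)] up down by (simp add: d_entry_def a)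
qed

section \<open>Linearity of the operator and invariance of the space\<close>

definition K3B_dom :: "(complex \<times> complex \<Rightarrow> complex) set" where
  "K3B_dom = {f. \<forall>u v. (\<lambda>w. f (w, v)) field_differentiable at u
     \<and> (\<lambda>w. f (u, w)) field_differentiable at v
     \<and> (\<lambda>w. partial1 f (w, v)) field_differentiable at u}"

lemma phi_in_K3B_dom: "phi h (a, b) \<in> K3B_dom"
  by (auto simp: K3B_dom_def phi_eq_monomial partial1_monomial
      intro!: derivative_intros field_differentiable_mult field_differentiable_power)

text \<open>As \<open>deriv\<close> is total, additivity is claimed only where the derivatives
  exist; \<open>K3B_dom\<close> collects the derivatives entering the operator. The third equation
  starts from the form that the first one produces.\<close>

lemma partial_add:
  assumes "f \<in> K3B_dom" "g \<in> K3B_dom"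
  shows "partial1 (f + g) = partial1 f + partial1 g"
    and "partial2 (f + g) = partial2 f + partial2 g"
    and "partial1 (partial1 f + partial1 g) = partial1 (partial1 f) + partial1 (partial1 g)"
proof -
  show "partial1 (f + g) = partial1 f + partial1 g"
    and "partial2 (f + g) = partial2 f + partial2 g"
    using assms by (auto simp: K3B_dom_def partial1_def partial2_def fun_eq_iff deriv_add)
  show "partial1 (partial1 f + partial1 g) = partial1 (partial1 f) + partial1 (partial1 g)"
    using assms by (auto simp: K3B_dom_def partial1_def fun_eq_iff deriv_add)
qed

lemma partial_scale:
  assumes "f \<in> K3B_dom"
  shows "partial1 (cfun_scale c f) = cfun_scale c (partial1 f)"
    and "partial2 (cfun_scale c f) = cfun_scale c (partial2 f)"
    and "partial1 (cfun_scale c (partial1 f)) = cfun_scale c (partial1 (partial1 f))"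
proof -
  show "partial1 (cfun_scale c f) = cfun_scale c (partial1 f)"
    and "partial2 (cfun_scale c f) = cfun_scale c (partial2 f)"
    using assms by (auto simp: K3B_dom_def partial1_def partial2_def cfun_scale_def fun_eq_iff)
  show "partial1 (cfun_scale c (partial1 f)) = cfun_scale c (partial1 (partial1 f))"
    using assms by (auto simp: K3B_dom_def partial1_def cfun_scale_def fun_eq_iff)
qed

lemma K3B_dom_add: "f \<in> K3B_dom \<Longrightarrow> g \<in> K3B_dom \<Longrightarrow> f + g \<in> K3B_dom"
  using partial_add(1)[of f g] by (auto simp: K3B_dom_def intro!: field_differentiable_add)

lemma K3B_dom_scale: "f \<in> K3B_dom \<Longrightarrow> cfun_scale c f \<in> K3B_dom"
  using partial_scale(1)[of f c]
  by (auto simp: K3B_dom_def cfun_scale_def intro!: field_differentiable_mult)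

lemma K3B_add:
  "f \<in> K3B_dom \<Longrightarrow> g \<in> K3B_dom \<Longrightarrow>
    K3B w1 w2 \<mu> h \<epsilon> (f + g) = K3B w1 w2 \<mu> h \<epsilon> f + K3B w1 w2 \<mu> h \<epsilon> g"
  by (simp add: K3B_def partial_add fun_eq_iff) (simp add: algebra_simps add_divide_distrib)

lemma K3B_scale:
  "f \<in> K3B_dom \<Longrightarrow> K3B w1 w2 \<mu> h \<epsilon> (cfun_scale c f) = cfun_scale c (K3B w1 w2 \<mu> h \<epsilon> f)"
  by (simp add: K3B_def partial_scale fun_eq_iff) (simp add: cfun_scale_def algebra_simps)

lemma K3B_HNB:
  assumes "h \<noteq> 0"
  shows "K3B w1 w2 \<mu> h \<epsilon> ` HNB h N \<subseteq> HNB h N"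
proof (intro image_subsetI)
  let ?B = "(\<lambda>l. phi h (N - 2 * l, l)) ` {..<N div 2 + 1}"
  fix f assume "f \<in> HNB h N"
  then have "f \<in> cfun.span ?B" by (simp only: HNB_eq_span)
  \<comment> \<open>Membership in \<open>K3B_dom\<close> is carried through the induction, since
    \<open>K3B_add\<close> and \<open>K3B_scale\<close> hold there.\<close>
  then have "f \<in> K3B_dom \<and> K3B w1 w2 \<mu> h \<epsilon> f \<in> cfun.span ?B"
  proof (induction rule: cfun.span_induct_alt)
    case base
    have "(\<lambda>_. 0) \<in> K3B_dom" by (simp add: K3B_dom_def partial1_def)
    moreover have "K3B w1 w2 \<mu> h \<epsilon> 0 = 0"
      by (simp add: K3B_def partial1_def partial2_def fun_eq_iff)
    ultimately show ?case by (simp add: zero_fun_def[symmetric] cfun.span_zero)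
  next
    case (step c g f)
    then obtain j where j: "j < N div 2 + 1" "g = phi h (N - 2 * j, j)" by auto
    have "K3B w1 w2 \<mu> h \<epsilon> g \<in> cfun.span ?B"
      unfolding j(2) K3B_phi_eq_lincomb[OF assms j(1)]
      by (intro cfun.span_sum cfun.span_scale cfun.span_base) auto
    moreover have "g \<in> K3B_dom" by (simp add: j(2) phi_in_K3B_dom)
    ultimately have "cfun_scale c g + f \<in> K3B_dom"
      and "K3B w1 w2 \<mu> h \<epsilon> (cfun_scale c g + f) \<in> cfun.span ?B"
      using step.IH
      by (auto simp only: K3B_add K3B_scale K3B_dom_add K3B_dom_scale
          intro: cfun.span_add cfun.span_scale)
    then show ?case by (simp only: plus_fun_def)
  qed
  then show "K3B w1 w2 \<mu> h \<epsilon> f \<in> HNB h N" by (simp only: HNB_eq_span)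
qed

section \<open>The matrix in the monomial basis\<close>

theorem theorem4p2:
  fixes V :: "real \<Rightarrow> real \<times> real \<Rightarrow> real" and x :: "real \<Rightarrow> real \<times> real"
    and \<omega>1 \<omega>2 :: "real \<Rightarrow> real" and \<omega>11 \<omega>21 \<mu> h \<epsilon> :: real and N :: nat
  assumes "h > 0"
    and "resonant_potential_family V x \<omega>1 \<omega>2 \<omega>11 \<omega>21"
    and "zden (V 0) \<noteq> 0"
    and "\<mu> = mu (V 0)"
  shows "ordered_basis (\<lambda>l. phi h (N - 2 * l, l)) (N div 2 + 1) (HNB h N) \<and>
    K3B \<omega>11 \<omega>21 \<mu> h \<epsilon> ` HNB h N \<subseteq> HNB h N \<and>
    matrix_in_basis (K3B \<omega>11 \<omega>21 \<mu> h \<epsilon>) (\<lambda>l. phi h (N - 2 * l, l)) (N div 2 + 1)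
      = map_mat complex_of_real (M_matrix \<omega>11 \<omega>21 \<mu> h \<epsilon> N) \<and>
    transpose_mat (M_matrix \<omega>11 \<omega>21 \<mu> h \<epsilon> N) = M_matrix \<omega>11 \<omega>21 \<mu> h \<epsilon> N"
proof (intro conjI)
  let ?n = "N div 2 + 1" and ?b = "\<lambda>l. phi h (N - 2 * l, l)"
  have h: "h \<noteq> 0" using assms(1) by simp
  show ob: "ordered_basis ?b ?n (HNB h N)" by (rule ordered_basis_phi[OF h])
  show "K3B \<omega>11 \<omega>21 \<mu> h \<epsilon> ` HNB h N \<subseteq> HNB h N" by (rule K3B_HNB[OF h])
  have inj: "inj_on ?b {..<?n}" and ind: "cfun.independent (?b ` {..<?n})"
    using ob by (auto simp only: ordered_basis_def)
  have dim: "dim_row (M_matrix \<omega>11 \<omega>21 \<mu> h \<epsilon> N) = ?n" "dim_col (M_matrix \<omega>11 \<omega>21 \<mu> h \<epsilon> N) = ?n"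
    by (simp_all add: M_matrix_def)
  show "matrix_in_basis (K3B \<omega>11 \<omega>21 \<mu> h \<epsilon>) ?b ?n
      = map_mat complex_of_real (M_matrix \<omega>11 \<omega>21 \<mu> h \<epsilon> N)"
  proof (rule eq_matI)
    fix i j
    assume "i < dim_row (map_mat complex_of_real (M_matrix \<omega>11 \<omega>21 \<mu> h \<epsilon> N))"
      and "j < dim_col (map_mat complex_of_real (M_matrix \<omega>11 \<omega>21 \<mu> h \<epsilon> N))"
    then have ij: "i < ?n" "j < ?n" by (simp_all only: index_map_mat dim)
    \<comment> \<open>Column \<open>j\<close> expands by \<open>K3B_phi_eq_lincomb\<close>, and
      \<open>representation_lincomb\<close> extracts its coefficient at \<open>i\<close>.\<close>
    show "matrix_in_basis (K3B \<omega>11 \<omega>21 \<mu> h \<epsilon>) ?b ?n $$ (i, j)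
        = map_mat complex_of_real (M_matrix \<omega>11 \<omega>21 \<mu> h \<epsilon> N) $$ (i, j)"
      using ij
      by (simp only: matrix_in_basis_def index_mat index_map_mat dim prod.case
          K3B_phi_eq_lincomb[OF h ij(2)] representation_lincomb[OF inj ind ij(1)])
  qed (simp_all add: matrix_in_basis_def dim)
  \<comment> \<open>Symmetry is visible in the form of \<open>M_matrix\<close>; its substance is the
    matrix equality above, where both shifts produce the same \<open>A_entry\<close>.\<close>
  show "transpose_mat (M_matrix \<omega>11 \<omega>21 \<mu> h \<epsilon> N) = M_matrix \<omega>11 \<omega>21 \<mu> h \<epsilon> N"
    by (rule eq_matI) (auto simp: M_matrix_def)
qed

end
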